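(* Let $a,b,m\in\mathbb{Z}$ with $a\ge 2$, $m>1$, $\gcd(b,m)=1$, and $b\ge -(a-2)m-2$, and let $S=S_{a,b}(m)$. Let $n$ be the smallest positive integer such that $A_n\ge m$. For each $k\in\{0,\ldots,m-1\}$, let $w(k)$ be the element of $\operatorname{Ap}(S)$ congruent to $k$ modulo $m$. Then $w(k)$ factorizes as \[ w(k)=\sum_{i=1}^{n-1}u^{(\ell_k)}_i s_i, \] where $\ell_k$ is the unique integer in $\{0,\ldots,m-1\}$ with $d\ell_k\equiv k\pmod m$ and $\mathbf{u}^{(\ell_k)}=(u^{(\ell_k)}_1,\ldots,u^{(\ell_k)}_{n-1})$ is the canonical representative of $\ell_k$. In particular, \[ \mathsf{L}_{\operatorname{msg}(S)}(w(k))=\left\{\sum_{i=1}^{n-1}u^{(\ell_k)}_i\right\}. \]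
   Context: $\mathbb{N}=\{0,1,2,\dots\}$. Let $T_{a,b}(z)=az+b$, with $T_{a,b}^i$ its $i$-fold composition ($T_{a,b}^0$ the identity), and let $S_{a,b}(m)=\langle T_{a,b}^i(m)\mid i\ge 0\rangle$ be the submonoid of $(\mathbb{N},+)$ generated by the orbit of $m$; under the stated hypotheses it is a numerical semigroup (finite complement in $\mathbb{N}$) whose smallest positive element is $m$. Set $d=(a-1)m+b$ (so $\gcd(d,m)=1$), $A_i=(a^i-1)/(a-1)$ for $i\ge 0$, and $s_i=T_{a,b}^i(m)=m+dA_i$. Since $m>1$, $n\ge 2$. $\operatorname{msg}(S)$ denotes the unique minimal system of generators of $S$; under the stated hypotheses $\operatorname{msg}(S)=\{s_0,\ldots,s_{n-1}\}$. The Apéry set is $\operatorname{Ap}(S)=\{s\in S\mid s-m\notin S\}$; it contains exactly one element in each residue class modulo $m$. $R(a,n)$ is the set of $\mathbf{u}=(u_1,\ldots,u_{n-1})\in\mathbb{N}^{n-1}$ such that $0\le u_j\le a$ for all $j$, and if $u_j=a$ then $u_k=0$ for every $k<j$. For each integer $0\le\ell<A_n$ there is a unique $\mathbf{u}^{(\ell)}=(u^{(\ell)}_1,\ldots,u^{(\ell)}_{n-1})\in R(a,n)$ with $\ell=\sum_{i=1}^{n-1}u^{(\ell)}_iA_i$, called the canonical representative of $\ell$. For a finite set $B\subset\mathbb{N}\setminus\{0\}$ and $s\in\mathbb{N}$, the set of factorization lengths is $\mathsf{L}_B(s)=\{\sum_{\beta\in B}u_\beta\mid s=\sum_{\beta\in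 B}u_\beta\,\beta,\ u_\beta\in\mathbb{N}\}$. *)

theory Defs
  imports Main "HOL-Library.FuncSet" "HOL-Number_Theory.Cong"
begin

inductive_set submonoid_gen :: "nat set \<Rightarrow> nat set" for B :: "nat set" where
  zero: "0 \<in> submonoid_gen B"
| gen: "x \<in> B \<Longrightarrow> x \<in> submonoid_gen B"
| add: "x \<in> submonoid_gen B \<Longrightarrow> y \<in> submonoid_gen B \<Longrightarrow> x + y \<in> submonoid_gen B"

definition T :: "int \<Rightarrow> int \<Rightarrow> int \<Rightarrow> int" where
  "T a b z = a * z + b"

text \<open>The generators are the natural numbers in the orbit of \<open>m\<close>. If \<open>a \<ge> 2\<close>, \<open>m > 1\<close> and
  \<open>b \<ge> - (a - 2) * m - 2\<close>, then \<open>(a - 1) * m + b \<ge> 0\<close>, so the orbit is nondecreasing and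
  none of it is left out.\<close>

definition S :: "int \<Rightarrow> int \<Rightarrow> int \<Rightarrow> nat set" where
  "S a b m = submonoid_gen {x. \<exists>i. int x = (T a b ^^ i) m}"

definition msg :: "nat set \<Rightarrow> nat set" where
  "msg M = (THE B. submonoid_gen B = M \<and> (\<forall>C. C \<subset> B \<longrightarrow> submonoid_gen C \<noteq> M))"

text \<open>The difference is taken in the integers, so that it is not truncated at 0.\<close>

definition Ap :: "nat set \<Rightarrow> int \<Rightarrow> nat set" where
  "Ap M m = {s \<in> M. int s - m \<notin> int ` M}"

definition ap_elem :: "nat set \<Rightarrow> int \<Rightarrow> int \<Rightarrow> nat" where
  "ap_elem M m k = (THE w. w \<in> Ap M m \<and> [int w = k] (mod m))"

text \<open>The division is exact for \<open>a \<ge> 2\<close>.\<close>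

definition A :: "int \<Rightarrow> nat \<Rightarrow> int" where
  "A a i = (a ^ i - 1) div (a - 1)"

text \<open>Tuples \<open>(u\<^sub>1, \<dots>, u\<^sub>n\<^sub>-\<^sub>1)\<close> are extensional functions on \<open>{1..n - 1}\<close>.\<close>

definition R :: "int \<Rightarrow> nat \<Rightarrow> (nat \<Rightarrow> nat) set" where
  "R a n = {u \<in> {1..n - 1} \<rightarrow>\<^sub>E UNIV. \<forall>j \<in> {1..n - 1}. int (u j) \<le> a \<and>
     (int (u j) = a \<longrightarrow> (\<forall>k \<in> {1..n - 1}. k < j \<longrightarrow> u k = 0))}"

definition canonical_rep :: "int \<Rightarrow> nat \<Rightarrow> int \<Rightarrow> nat \<Rightarrow> nat" where
  "canonical_rep a n l = (THE u. u \<in> R a n \<and> l = (\<Sum>i = 1..n - 1. int (u i) * A a i))"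

definition ell :: "int \<Rightarrow> int \<Rightarrow> int \<Rightarrow> int \<Rightarrow> int" where
  "ell a b m k = (THE l. l \<in> {0..m - 1} \<and> [((a - 1) * m + b) * l = k] (mod m))"

text \<open>Meaningful for finite \<open>B\<close> only, since sums over infinite sets are 0.\<close>

definition factorization_lengths :: "nat set \<Rightarrow> nat \<Rightarrow> nat set" where
  "factorization_lengths B s = {(\<Sum>\<beta>\<in>B. u \<beta>) |u :: nat \<Rightarrow> nat. s = (\<Sum>\<beta>\<in>B. u \<beta> * \<beta>)}"

end

theory Submission
  imports Defs
begin

text \<open>
  Write an element of the semigroup as \<open>\<Sum> u\<^sub>i s\<^sub>i = m |u| + d \<Sum> u\<^sub>i A\<^sub>i\<close>. Modulo \<open>m\<close> it determines
  \<open>\<ell>\<close> with \<open>\<Sum> u\<^sub>i A\<^sub>i = \<ell> + t m\<close>, so minimising it in its class means minimising \<open>|u| + d t\<close>.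
  If \<open>t \<ge> 1\<close>, then \<open>|u| \<ge> 2\<close> because every \<open>A\<^sub>i\<close> in use is below \<open>m\<close>, and \<open>|u| + d t \<ge> m > \<ell>\<close>
  already exceeds the length of the canonical representative of \<open>\<ell>\<close>. If \<open>t = 0\<close>, the exchange
  \<open>a A\<^sub>j + A\<^sub>k = A\<^sub>j\<^sub>+\<^sub>1 + a A\<^sub>k\<^sub>-\<^sub>1\<close> (\<open>k \<le> j\<close>) turns \<open>u\<close> into the canonical representative without
  changing the number of summands, as long as the summand \<open>A\<^sub>0 = 0\<close> is counted.
\<close>

section \<open>The numbers \<open>A a i\<close> over the naturals\<close>

text \<open>The recursion replaces the exact division in \<open>A\<close>;
  \<open>int_repunit\<close> shows that the two agree.\<close>

primrec repunit :: "nat \<Rightarrow> nat \<Rightarrow> nat" where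
  "repunit a 0 = 0"
| "repunit a (Suc i) = a * repunit a i + 1"

lemma int_repunit:
  assumes "2 \<le> a"
  shows "int (repunit a i) = A (int a) i"
proof -
  have "int a ^ i = (int a - 1) * int (repunit a i) + 1"
  proof (induction i)
    case (Suc i)
    show ?case
      unfolding power_Suc Suc by (simp add: algebra_simps)
  qed simp
  then show ?thesis
    using assms by (simp add: A_def)
qed

lemma repunit_strict_mono:
  assumes "2 \<le> a"
  shows "strict_mono (repunit a)"
proof (rule strict_mono_Suc_iff[THEN iffD2], rule allI)
  fix i
  have "repunit a i \<le> a * repunit a i"
    using assms by simp
  then show "repunit a i < repunit a (Suc i)"
    by (simp only: repunit.simps)
qed

lemma repunit_pos: "0 < i \<Longrightarrow> 0 < repunit a i"
  by (cases i) auto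

section \<open>Exchanges and canonical tuples\<close>

text \<open>The weight \<open>f\<close> is arbitrary because the same exchange is evaluated for the
  length (\<open>f = 1\<close>), the value (\<open>f = repunit a\<close>) and the sum of squares.
  All changes are added, on one side or the other, so that nothing is truncated and coinciding
  indices need no separate treatment.\<close>

lemma sum_exchange:
  fixes f u v :: "nat \<Rightarrow> nat"
  assumes "\<And>i. v i + (if i = j then a else 0) + (if i = k then 1 else 0)
                = u i + (if i = p then 1 else 0) + (if i = q then a else 0)"
    and "j \<le> N" "k \<le> N" "p \<le> N" "q \<le> N"
  shows "(\<Sum>i\<le>N. v i * f i) + a * f j + f k = (\<Sum>i\<le>N. u i * f i) + f p + a * f q"
proof -
  have delta: "(\<Sum>i\<le>N. (if i = r then c else 0) * f i) = c * f r" if "r \<le> N" for r c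
  proof -
    have "(\<Sum>i\<le>N. (if i = r then c else 0) * f i) = (\<Sum>i\<le>N. if i = r then c * f r else 0)"
      by (intro sum.cong) auto
    then show ?thesis using that by simp
  qed
  have "(\<Sum>i\<le>N. (v i + (if i = j then a else 0) + (if i = k then 1 else 0)) * f i)
      = (\<Sum>i\<le>N. (u i + (if i = p then 1 else 0) + (if i = q then a else 0)) * f i)"
    using assms(1) by simp
  then show ?thesis
    using assms(2-) by (simp only: distrib_right sum.distrib delta)
qed

text \<open>The defining condition of \<open>R\<close>, with \<open>N = n - 1\<close> and without extensionality.\<close>

definition canonical :: "nat \<Rightarrow> nat \<Rightarrow> (nat \<Rightarrow> nat) \<Rightarrow> bool" where
  "canonical a N u \<longleftrightarrow> (\<forall>j\<in>{1..N}. u j \<le> a \<and> (u j = a \<longrightarrow> (\<forall>k\<in>{1..N}. k < j \<longrightarrow> u k = 0)))"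

lemma canonical_Suc: "canonical a (Suc N) u \<Longrightarrow> canonical a N u"
  unfolding canonical_def by auto

text \<open>Induction on the top index: if the top entry is \<open>a\<close>, all lower entries
  vanish; otherwise the lower part is by induction less than one more copy of the top term. Either
  way the value is at most \<open>a\<close> times the top term.\<close>

lemma canonical_sum_less:
  "canonical a N u \<Longrightarrow> (\<Sum>i=1..N. u i * repunit a i) < repunit a (Suc N)"
proof (induction N)
  case 0
  then show ?case by simp
next
  case (Suc N)
  define A' where "A' = repunit a (Suc N)"
  have less: "(\<Sum>i=1..N. u i * repunit a i) < A'"
    unfolding A'_def using Suc canonical_Suc by blast
  have sum: "(\<Sum>i=1..Suc N. u i * repunit a i) = (\<Sum>i=1..N. u i * repunit a i) + u (Suc N) * A'"
    unfolding A'_def by (simp del: repunit.simps)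
  have "(\<Sum>i=1..Suc N. u i * repunit a i) \<le> a * A'"
  proof (cases "u (Suc N) = a")
    case True
    then have "u k = 0" if "k \<in> {1..N}" for k
      using Suc.prems that unfolding canonical_def by auto
    then have "(\<Sum>i=1..N. u i * repunit a i) = 0"
      by simp
    then show ?thesis
      unfolding sum using True by simp
  next
    case False
    then have "Suc (u (Suc N)) \<le> a"
      using Suc.prems unfolding canonical_def by (simp add: le_neq_implies_less Suc_leI)
    then have "Suc (u (Suc N)) * A' \<le> a * A'"
      by (rule mult_right_mono) simp
    then show ?thesis
      unfolding sum using less by simp
  qed
  then show ?case
    by (simp add: A'_def)
qed

text \<open>By \<open>canonical_sum_less\<close> the lower part is a remainder modulo the top term,
  so division recovers the top entry and induction the others.\<close>

lemma canonical_unique: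
  assumes "canonical a N u" "canonical a N v"
    and "(\<Sum>i=1..N. u i * repunit a i) = (\<Sum>i=1..N. v i * repunit a i)"
    and "i \<in> {1..N}"
  shows "u i = v i"
  using assms
proof (induction N)
  case 0
  then show ?case by simp
next
  case (Suc N)
  define A' where "A' = repunit a (Suc N)"
  define r where "r w = (\<Sum>i=1..N. w i * repunit a i)" for w :: "nat \<Rightarrow> nat"
  have sum: "(\<Sum>i=1..Suc N. w i * repunit a i) = r w + w (Suc N) * A'" for w
    unfolding A'_def r_def by (simp del: repunit.simps)
  have less: "r u < A'" "r v < A'"
    unfolding A'_def r_def using Suc.prems canonical_Suc canonical_sum_less by blast+
  have eq: "r u + u (Suc N) * A' = r v + v (Suc N) * A'"
    using Suc.prems(3) unfolding sum .
  have top: "u (Suc N) = v (Suc N)"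
    using arg_cong[OF eq, of "\<lambda>x. x div A'"] less by simp
  then have "r u = r v"
    using eq by simp
  then show ?case
    using Suc top canonical_Suc unfolding r_def by (cases "i = Suc N") auto
qed

text \<open>The exchange raises \<open>\<Sum> u\<^sub>i A\<^sub>i\<^sup>2\<close>, which is bounded by \<open>(\<Sum> u\<^sub>i A\<^sub>i)\<^sup>2\<close>; hence it terminates.\<close>

lemma exchange_sq_less:
  fixes a p q :: nat
  assumes "2 \<le> a" "q < p"
  shows "a * p\<^sup>2 + (a * q + 1)\<^sup>2 < (a * p + 1)\<^sup>2 + a * q\<^sup>2"
proof -
  \<comment> \<open>The product is the right side of the claim minus its left side,
    factored.\<close>
  have "0 < (int p - int q) * ((int a - 1) * (int p + int q) + 2) * int a"
    using assms by (intro mult_pos_pos add_nonneg_pos mult_nonneg_nonneg) auto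
  then have "int (a * p\<^sup>2 + (a * q + 1)\<^sup>2) < int ((a * p + 1)\<^sup>2 + a * q\<^sup>2)"
    by (simp add: power2_eq_square algebra_simps)
  then show ?thesis
    by (simp only: of_nat_less_iff)
qed

lemma sum_sq_le:
  fixes u f :: "nat \<Rightarrow> nat"
  assumes "finite I"
  shows "(\<Sum>i\<in>I. u i * (f i)\<^sup>2) \<le> (\<Sum>i\<in>I. u i * f i)\<^sup>2"
proof -
  have "(\<Sum>i\<in>I. u i * (f i)\<^sup>2) \<le> (\<Sum>i\<in>I. (u i * f i) * (\<Sum>i\<in>I. u i * f i))"
  proof (rule sum_mono)
    fix i assume "i \<in> I"
    then have *: "u i * f i \<le> (\<Sum>i\<in>I. u i * f i)"
      using assms by (intro member_le_sum) auto
    have "u i * (f i)\<^sup>2 \<le> (u i * f i) * (u i * f i)"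
      by (simp add: power2_eq_square)
    also have "\<dots> \<le> (u i * f i) * (\<Sum>i\<in>I. u i * f i)"
      using * by (rule mult_left_mono) simp
    finally show "u i * (f i)\<^sup>2 \<le> (u i * f i) * (\<Sum>i\<in>I. u i * f i)" .
  qed
  then show ?thesis
    by (simp add: power2_eq_square sum_distrib_right)
qed

text \<open>An entry above \<open>a\<close> gives \<open>k = j\<close>; an entry equal to
  \<open>a\<close> with a nonzero entry below it gives \<open>k < j\<close>. Either way
  \<open>u\<close> contains all the summands that an exchange removes.\<close>

lemma not_canonicalE:
  assumes "\<not> canonical a N u" "2 \<le> a"
  obtains j k where "1 \<le> k" "k \<le> j" "j \<le> N"
    "\<And>i. (if i = j then a else 0) + (if i = k then 1 else 0) \<le> u i"
proof -
  from assms(1) obtain j where j: "j \<in> {1..N}"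
    and "\<not> (u j \<le> a \<and> (u j = a \<longrightarrow> (\<forall>k\<in>{1..N}. k < j \<longrightarrow> u k = 0)))"
    unfolding canonical_def by blast
  from this(2) have "a < u j \<or> (u j = a \<and> (\<exists>k\<in>{1..N}. k < j \<and> 0 < u k))"
    by (metis not_le not_gr_zero)
  then show thesis
  proof
    assume "a < u j"
    with j show thesis by (intro that[of j j]) auto
  next
    assume "u j = a \<and> (\<exists>k\<in>{1..N}. k < j \<and> 0 < u k)"
    then obtain k where "u j = a" "1 \<le> k" "k < j" "0 < u k" by auto
    with j show thesis by (intro that[of k j]) auto
  qed
qed

lemma canonical_exists:
  assumes "2 \<le> a" "(\<Sum>i\<le>N. u i * repunit a i) < repunit a (Suc N)"
  shows "\<exists>c. canonical a N c \<and> (\<Sum>i\<le>N. c i) = (\<Sum>i\<le>N. u i)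
           \<and> (\<Sum>i\<le>N. c i * repunit a i) = (\<Sum>i\<le>N. u i * repunit a i)"
  using assms(2)
proof (induction "(\<Sum>i\<le>N. u i * repunit a i)\<^sup>2 - (\<Sum>i\<le>N. u i * (repunit a i)\<^sup>2)"
    arbitrary: u rule: less_induct)
  case less
  show ?case
  proof (cases "canonical a N u")
    case True
    then show ?thesis by blast
  next
    case False
    obtain j k where jk: "1 \<le> k" "k \<le> j" "j \<le> N"
      and le: "\<And>i. (if i = j then a else 0) + (if i = k then 1 else 0) \<le> u i"
      by (rule not_canonicalE[OF False assms(1)]) (rule that)
    \<comment> \<open>The tuple after the exchange. By \<open>le\<close> the subtraction is not
      truncated; \<open>k - 1\<close> may be 0, which is why index 0 is carried along.\<close>
    define v where "v i = u i + (if i = Suc j then 1 else 0) + (if i = k - 1 then a else 0)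
        - ((if i = j then a else 0) + (if i = k then 1 else 0))" for i
    have v: "v i + (if i = j then a else 0) + (if i = k then 1 else 0)
        = u i + (if i = Suc j then 1 else 0) + (if i = k - 1 then a else 0)" for i
      using le[of i] unfolding v_def by linarith
    have k: "k = Suc (k - 1)"
      using jk by simp
    have rk: "repunit a k = a * repunit a (k - 1) + 1"
      by (subst k) simp
    \<comment> \<open>An exchange at \<open>j = N\<close> would need the index \<open>N + 1\<close>.
      But \<open>a\<close> copies of the term at \<open>N\<close> and one at
      \<open>k \<ge> 1\<close> already reach \<open>a * repunit a N + 1\<close>, against the bound
      on the value.\<close>
    have "j \<noteq> N"
    proof
      assume "j = N"
      have "(\<Sum>i\<le>N. ((if i = N then a else 0) + (if i = k then 1 else 0)) * repunit a i)
          \<le> (\<Sum>i\<le>N. u i * repunit a i)"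
        using le unfolding \<open>j = N\<close> by (intro sum_mono mult_right_mono) auto
      moreover have "(\<Sum>i\<le>N. ((if i = N then a else 0) + (if i = k then 1 else 0)) * repunit a i)
          = a * repunit a N + repunit a k"
        using sum_exchange[of "\<lambda>_. 0" N a k
            "\<lambda>i. (if i = N then a else 0) + (if i = k then 1 else 0)" 0 0 N "repunit a"]
          jk
        by (simp add: distrib_right sum.distrib if_distrib[of "\<lambda>x. x * _"] cong: if_cong)
      ultimately show False
        using less.prems rk by simp
    qed
    then have N: "j \<le> N" "k \<le> N" "Suc j \<le> N" "k - 1 \<le> N"
      using jk by auto
    note exch = sum_exchange[OF v N]
    have len: "(\<Sum>i\<le>N. v i) = (\<Sum>i\<le>N. u i)"
      using exch[of "\<lambda>_. 1"] by simp
    have val: "(\<Sum>i\<le>N. v i * repunit a i) = (\<Sum>i\<le>N. u i * repunit a i)"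
      using exch[of "repunit a"] rk by simp
    have "repunit a (k - 1) < repunit a j"
      using strict_monoD[OF repunit_strict_mono[OF assms(1)]] jk by simp
    from exchange_sq_less[OF assms(1) this]
    have "(\<Sum>i\<le>N. u i * (repunit a i)\<^sup>2) < (\<Sum>i\<le>N. v i * (repunit a i)\<^sup>2)"
      using exch[of "\<lambda>i. (repunit a i)\<^sup>2"] rk by simp
    \<comment> \<open>The measure is a truncated difference; this bound on the new tuple ensures
      that it really drops.\<close>
    moreover have "(\<Sum>i\<le>N. v i * (repunit a i)\<^sup>2) \<le> (\<Sum>i\<le>N. v i * repunit a i)\<^sup>2"
      by (rule sum_sq_le) simp
    ultimately have "(\<Sum>i\<le>N. v i * repunit a i)\<^sup>2 - (\<Sum>i\<le>N. v i * (repunit a i)\<^sup>2)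
        < (\<Sum>i\<le>N. u i * repunit a i)\<^sup>2 - (\<Sum>i\<le>N. u i * (repunit a i)\<^sup>2)"
      unfolding val by linarith
    from less.hyps[OF this] show ?thesis
      using less.prems len val by simp
  qed
qed

lemma sum_atMost_split: "(\<Sum>i\<le>N. f i) = f 0 + (\<Sum>i=1..N. f i)" for f :: "nat \<Rightarrow> nat"
  by (simp add: atMost_atLeast0 sum.atLeast_Suc_atMost)

text \<open>Reducing \<open>u\<close> by exchanges keeps its length and, by uniqueness, ends in
  \<open>c\<close> on \<open>{1..N}\<close>. Slack can arise only from the entry at index 0, which
  contributes to the length but not to the value.\<close>

lemma canonical_minimal:
  assumes "2 \<le> a" "canonical a N c"
    and "(\<Sum>i\<le>N. u i * repunit a i) = (\<Sum>i=1..N. c i * repunit a i)"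
  shows "(\<Sum>i=1..N. c i) \<le> (\<Sum>i\<le>N. u i)"
proof -
  have "(\<Sum>i\<le>N. u i * repunit a i) < repunit a (Suc N)"
    unfolding assms(3) using assms(2) by (rule canonical_sum_less)
  then obtain c' where c': "canonical a N c'" "(\<Sum>i\<le>N. c' i) = (\<Sum>i\<le>N. u i)"
    "(\<Sum>i\<le>N. c' i * repunit a i) = (\<Sum>i\<le>N. u i * repunit a i)"
    using canonical_exists[OF assms(1)] by blast
  then have "c i = c' i" if "i \<in> {1..N}" for i
    using canonical_unique[OF assms(2) c'(1) _ that] assms(3) by (simp add: sum_atMost_split)
  then show ?thesis
    unfolding c'(2)[symmetric] by (simp add: sum_atMost_split)
qed

section \<open>Generated submonoids, minimal generators and the Apery set\<close>

lemma submonoid_gen_subsetI: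
  assumes "B \<subseteq> submonoid_gen C"
  shows "submonoid_gen B \<subseteq> submonoid_gen C"
proof
  fix x assume "x \<in> submonoid_gen B"
  then show "x \<in> submonoid_gen C"
    by induction (use assms in \<open>auto intro: submonoid_gen.intros\<close>)
qed

lemma submonoid_gen_mult: "x \<in> submonoid_gen B \<Longrightarrow> c * x \<in> submonoid_gen B"
  by (induction c) (auto intro: submonoid_gen.intros)

lemma submonoid_gen_sum:
  assumes "\<And>i. i \<in> I \<Longrightarrow> f i \<in> submonoid_gen B"
  shows "(\<Sum>i\<in>I. u i * f i) \<in> submonoid_gen B"
  using assms
proof (induction I rule: infinite_finite_induct)
  case (insert x I)
  then show ?case
    unfolding sum.insert[OF insert.hyps] by (intro submonoid_gen.add submonoid_gen_mult) blast+
qed (simp_all add: submonoid_gen.zero)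

lemma submonoid_gen_imageE:
  assumes "x \<in> submonoid_gen (f ` {..N::nat})"
  obtains u where "x = (\<Sum>i\<le>N. u i * f i)"
proof -
  from assms have "\<exists>u. x = (\<Sum>i\<le>N. u i * f i)"
  proof induction
    case zero
    show ?case by (rule exI[of _ "\<lambda>_. 0"]) simp
  next
    case (gen x)
    then obtain j where "j \<le> N" "x = f j" by auto
    then have "x = (\<Sum>i\<le>N. (if i = j then 1 else 0) * f i)"
      by (simp add: if_distrib[of "\<lambda>x. x * _"] cong: if_cong)
    then show ?case by (rule exI[of _ "\<lambda>i. if i = j then 1 else 0"])
  next
    case (add x y)
    then obtain u v where "x = (\<Sum>i\<le>N. u i * f i)" "y = (\<Sum>i\<le>N. v i * f i)" by blast
    then have "x + y = (\<Sum>i\<le>N. (u i + v i) * f i)"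
      by (simp add: distrib_right sum.distrib)
    then show ?case by (rule exI[of _ "\<lambda>i. u i + v i"])
  qed
  with that show thesis by blast
qed

lemma submonoid_gen_irreducible:
  assumes "x \<in> submonoid_gen B" "x \<noteq> 0"
    and "\<And>y z. y \<in> submonoid_gen B \<Longrightarrow> z \<in> submonoid_gen B \<Longrightarrow> y \<noteq> 0 \<Longrightarrow> z \<noteq> 0 \<Longrightarrow> x \<noteq> y + z"
  shows "x \<in> B"
  using assms
proof induction
  case (add x y)
  then show ?case by (cases "x = 0"; cases "y = 0") auto
qed auto

text \<open>Irreducible elements lie in every generating set. So \<open>G\<close> is the least
  generating set and hence the only minimal one, which justifies the definite description in
  \<open>msg\<close>.\<close>

lemma msg_eqI:
  assumes gen: "submonoid_gen G = M" and pos: "0 \<notin> G"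
    and irr: "\<And>g y z. g \<in> G \<Longrightarrow> y \<in> M \<Longrightarrow> z \<in> M \<Longrightarrow> y \<noteq> 0 \<Longrightarrow> z \<noteq> 0 \<Longrightarrow> g \<noteq> y + z"
  shows "msg M = G"
proof -
  have sub: "G \<subseteq> B" if "submonoid_gen B = M" for B
  proof
    fix g assume g: "g \<in> G"
    show "g \<in> B"
    proof (rule submonoid_gen_irreducible)
      show "g \<in> submonoid_gen B"
        using g gen that submonoid_gen.gen by blast
      show "g \<noteq> 0"
        using g pos by metis
    qed (use g irr that in blast)
  qed
  show ?thesis
    unfolding msg_def
  proof (rule the_equality)
    show "submonoid_gen G = M \<and> (\<forall>C. C \<subset> G \<longrightarrow> submonoid_gen C \<noteq> M)"
      using gen sub by blast
  next
    fix B assume "submonoid_gen B = M \<and> (\<forall>C. C \<subset> B \<longrightarrow> submonoid_gen C \<noteq> M)"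
    then show "B = G"
      using gen sub by blast
  qed
qed

text \<open>Every element of \<open>M\<close> in the class of \<open>w\<close> is
  \<open>w + q * m\<close>. For \<open>q > 0\<close> subtracting \<open>m\<close> stays in
  \<open>M\<close>, so only the least element of the class survives. The equivalence lets the
  description in \<open>ap_elem\<close> be rewritten directly.\<close>

lemma Ap_unique:
  assumes w: "w \<in> M" and m: "0 < m"
    and closed: "\<And>x c. x \<in> M \<Longrightarrow> x + c * m \<in> M"
    and min: "\<And>x. x \<in> M \<Longrightarrow> [x = w] (mod m) \<Longrightarrow> w \<le> x"
  shows "w' \<in> Ap M (int m) \<and> [int w' = int w] (mod int m) \<longleftrightarrow> w' = w"
proof
  assume *: "w' \<in> Ap M (int m) \<and> [int w' = int w] (mod int m)"
  then have w': "w' \<in> M" "[w' = w] (mod m)"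
    by (auto simp: Ap_def cong_int_iff)
  then have "w \<le> w'"
    using min by blast
  then obtain q where q: "w' = w + q * m"
    using w'(2) by (metis cong_le_nat mult.commute add.commute)
  show "w' = w"
  proof (cases q)
    case (Suc c)
    then have "int w' - int m = int (w + c * m)"
      using q by simp
    then have "int w' - int m \<in> int ` M"
      using closed[OF w, of c] by (metis imageI)
    then show ?thesis
      using * by (simp add: Ap_def)
  qed (use q in simp)
next
  assume "w' = w"
  moreover have "int w - int m \<noteq> int x" if "x \<in> M" for x
  proof
    assume "int w - int m = int x"
    then have x: "w = x + m" by linarith
    then have "[x = w] (mod m)" by (simp add: cong_def)
    then show False
      using min[OF that] x m by simp
  qed
  ultimately show "w' \<in> Ap M (int m) \<and> [int w' = int w] (mod int m)"
    using w by (auto simp: Ap_def)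
qed

section \<open>The semigroup in natural-number parameters\<close>

text \<open>Here \<open>N\<close> is n - 1: the last two bounds express minimality of n. The lower
  bound on \<open>b\<close> becomes \<open>d_ge\<close>, written additively to avoid
  truncation.\<close>

locale repunit_orbit =
  fixes a m d N :: nat
  assumes a: "2 \<le> a" and m: "2 \<le> m" and d: "0 < d" and d_ge: "m \<le> d + 2"
    and coprime: "coprime d m"
    and N: "0 < N" "repunit a N < m" "m \<le> repunit a (Suc N)"
begin

definition s :: "nat \<Rightarrow> nat" where "s i = m + d * repunit a i"

lemma sum_s: "(\<Sum>i\<in>I. u i * s i) = m * (\<Sum>i\<in>I. u i) + d * (\<Sum>i\<in>I. u i * repunit a i)"
  unfolding s_def by (simp add: distrib_left sum.distrib sum_distrib_left mult_ac)

lemma inj_s: "inj s"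
  using strict_mono_imp_inj_on[OF repunit_strict_mono[OF a]] d by (auto simp: inj_def s_def)

lemma repunit_less: "i \<le> N \<Longrightarrow> repunit a i < m"
  using N strict_mono_less_eq[OF repunit_strict_mono[OF a]] by (meson le_less_trans)

lemma canonical_ex1:
  assumes "l < m"
  shows "\<exists>!c. c \<in> {1..N} \<rightarrow>\<^sub>E UNIV \<and> canonical a N c \<and> (\<Sum>i=1..N. c i * repunit a i) = l"
proof -
  \<comment> \<open>Since \<open>repunit a 1 = 1\<close>, taking \<open>l\<close> copies at index 1
    represents \<open>l\<close>; reducing this tuple gives existence.\<close>
  have "(\<Sum>i\<le>N. (if i = 1 then l else 0) * repunit a i) = l"
    using N by (simp add: if_distrib[of "\<lambda>x. x * _"] cong: if_cong)
  then obtain c where "canonical a N c" "(\<Sum>i\<le>N. c i * repunit a i) = l"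
    using canonical_exists[OF a, where N = N and u = "\<lambda>i. if i = 1 then l else 0"] assms N by auto
  then have "canonical a N (restrict c {1..N})"
    "(\<Sum>i=1..N. restrict c {1..N} i * repunit a i) = l"
    by (auto simp: canonical_def sum_atMost_split)
  moreover have "u = v"
    if "u \<in> {1..N} \<rightarrow>\<^sub>E UNIV" "canonical a N u" "(\<Sum>i=1..N. u i * repunit a i) = l"
      "v \<in> {1..N} \<rightarrow>\<^sub>E UNIV" "canonical a N v" "(\<Sum>i=1..N. v i * repunit a i) = l" for u v
    using that canonical_unique[of a N u v] by (intro PiE_ext[of u "{1..N}" "\<lambda>_. UNIV" v]) auto
  moreover have "restrict c {1..N} \<in> {1..N} \<rightarrow>\<^sub>E UNIV"
    by simp
  ultimately show ?thesis
    by blast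
qed

lemma length_le_value: "(\<Sum>i=1..N. c i) \<le> (\<Sum>i=1..N. c i * repunit a i)"
proof (rule sum_mono)
  fix i assume "i \<in> {1..N}"
  then have "0 < repunit a i" by (simp add: repunit_pos)
  then show "c i \<le> c i * repunit a i" by simp
qed

lemma value_le_length: "(\<Sum>i\<le>N. u i * repunit a i) \<le> (\<Sum>i\<le>N. u i) * repunit a N"
proof -
  have "(\<Sum>i\<le>N. u i * repunit a i) \<le> (\<Sum>i\<le>N. u i * repunit a N)"
    using strict_mono_less_eq[OF repunit_strict_mono[OF a]] by (intro sum_mono mult_left_mono) auto
  then show ?thesis by (simp add: sum_distrib_right)
qed

text \<open>The compared quantities are the coefficients of \<open>m\<close> in the two sums of
  generators, once \<open>d * l\<close> is split off. The case \<open>t = 0\<close> is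
  \<open>canonical_minimal\<close>; for \<open>t > 0\<close> the inequality is strict, which yields
  the second claim.\<close>

lemma canonical_length_le:
  assumes c: "canonical a N c" "(\<Sum>i=1..N. c i * repunit a i) = l" and l: "l < m"
    and u: "(\<Sum>i\<le>N. u i * repunit a i) = l + t * m"
  shows "(\<Sum>i=1..N. c i) \<le> (\<Sum>i\<le>N. u i) + d * t"
    and "(\<Sum>i=1..N. c i) = (\<Sum>i\<le>N. u i) + d * t \<Longrightarrow> t = 0"
proof -
  have less: "(\<Sum>i=1..N. c i) < (\<Sum>i\<le>N. u i) + d * t" if "0 < t"
  proof -
    have "m \<le> t * m" using that by simp
    then have "m \<le> (\<Sum>i\<le>N. u i) * repunit a N"
      using u value_le_length[of u] by linarith
    \<comment> \<open>A single summand is worth at most \<open>repunit a N\<close>, which is below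
      \<open>m\<close>.\<close>
    then have "\<not> (\<Sum>i\<le>N. u i) \<le> 1"
      using N(2) mult_right_mono[of "\<Sum>i\<le>N. u i" 1 "repunit a N"] by linarith
    moreover have "d \<le> d * t" using that by simp
    moreover have "(\<Sum>i=1..N. c i) < m"
      using length_le_value[of c] c(2) l by linarith
    ultimately show ?thesis using d_ge by linarith
  qed
  show "(\<Sum>i=1..N. c i) \<le> (\<Sum>i\<le>N. u i) + d * t"
  proof (cases "t = 0")
    case True
    then show ?thesis using canonical_minimal[OF a c(1), of u] u c(2) by simp
  qed (use less in simp)
  show "(\<Sum>i=1..N. c i) = (\<Sum>i\<le>N. u i) + d * t \<Longrightarrow> t = 0"
    using less by fastforce
qed

lemma value_cong:
  assumes "[(\<Sum>i\<le>N. u i * s i) = d * l] (mod m)"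
  shows "[(\<Sum>i\<le>N. u i * repunit a i) = l] (mod m)"
proof -
  have "[d * (\<Sum>i\<le>N. u i * repunit a i) = d * l] (mod m)"
    using assms unfolding sum_s by (simp add: cong_def)
  then show ?thesis
    using coprime by (simp add: cong_mult_lcancel_nat)
qed

lemma value_decompose:
  assumes "[v = l] (mod m)" "l < m"
  obtains t where "v = l + t * m"
proof
  show "v = l + (v div m) * m"
    using assms by (metis cong_def mod_less mod_div_decomp add.commute)
qed

lemma canonical_sum_minimal:
  assumes c: "canonical a N c" "(\<Sum>i=1..N. c i * repunit a i) = l" and l: "l < m"
    and u: "[(\<Sum>i\<le>N. u i * s i) = d * l] (mod m)"
  shows "(\<Sum>i=1..N. c i * s i) \<le> (\<Sum>i\<le>N. u i * s i)"
    and "(\<Sum>i=1..N. c i * s i) = (\<Sum>i\<le>N. u i * s i) \<Longrightarrow> (\<Sum>i\<le>N. u i) = (\<Sum>i=1..N. c i)"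
proof -
  obtain t where t: "(\<Sum>i\<le>N. u i * repunit a i) = l + t * m"
    using value_decompose[OF value_cong[OF u] l] .
  have us: "(\<Sum>i\<le>N. u i * s i) = m * ((\<Sum>i\<le>N. u i) + d * t) + d * l"
    unfolding sum_s t by (simp add: algebra_simps)
  have cs: "(\<Sum>i=1..N. c i * s i) = m * (\<Sum>i=1..N. c i) + d * l"
    unfolding sum_s c(2) ..
  show "(\<Sum>i=1..N. c i * s i) \<le> (\<Sum>i\<le>N. u i * s i)"
    unfolding us cs using canonical_length_le(1)[OF c l t] by simp
  assume "(\<Sum>i=1..N. c i * s i) = (\<Sum>i\<le>N. u i * s i)"
  then have "(\<Sum>i=1..N. c i) = (\<Sum>i\<le>N. u i) + d * t"
    unfolding us cs using m by simp
  with canonical_length_le(2)[OF c l t] show "(\<Sum>i\<le>N. u i) = (\<Sum>i=1..N. c i)"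
    by simp
qed

text \<open>Divide \<open>repunit a i\<close> by \<open>m\<close>. Quotient 0 forces
  \<open>i \<le> N\<close>. Otherwise \<open>s i = m * (1 + d * t) + d * l\<close>, and a
  representation of \<open>l\<close> supplies \<open>d * l\<close> with few enough generators that
  the surplus is filled by copies of \<open>s 0 = m\<close>.\<close>

lemma s_in_gen: "s i \<in> submonoid_gen (s ` {..N})"
proof -
  define l where "l = repunit a i mod m"
  define t where "t = repunit a i div m"
  have l: "l < m" and lt: "repunit a i = l + t * m"
    using m by (auto simp: l_def t_def)
  show ?thesis
  proof (cases "t = 0")
    case True
    then have "repunit a i < repunit a (Suc N)"
      using lt l N(3) by simp
    then have "i \<le> N"
      using strict_mono_less[OF repunit_strict_mono[OF a]] by (meson less_Suc_eq_le)
    then show ?thesis by (auto intro: submonoid_gen.gen)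
  next
    case False
    obtain c where c: "(\<Sum>j=1..N. c j * repunit a j) = l"
      using canonical_ex1[OF l] by blast
    have "d \<le> d * t" using False by simp
    \<comment> \<open>The length is at most \<open>l\<close>, and
      \<open>l \<le> m - 1 \<le> d + 1\<close> by \<open>d_ge\<close>.\<close>
    then have "(\<Sum>j=1..N. c j) \<le> 1 + d * t"
      using length_le_value[of c] c l d_ge by linarith
    then obtain e where e: "1 + d * t = (\<Sum>j=1..N. c j) + e"
      using le_Suc_ex by blast
    have "s i = m * (1 + d * t) + d * l"
      unfolding s_def lt by (simp add: algebra_simps)
    also have "\<dots> = (\<Sum>j=1..N. c j * s j) + e * s 0"
      unfolding e sum_s c by (simp add: s_def algebra_simps)
    also have "\<dots> \<in> submonoid_gen (s ` {..N})"
      by (intro submonoid_gen.add submonoid_gen_sum submonoid_gen_mult submonoid_gen.gen) auto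
    finally show ?thesis .
  qed
qed

lemma gen_range_s: "submonoid_gen (range s) = submonoid_gen (s ` {..N})"
  using s_in_gen by (intro equalityI submonoid_gen_subsetI) (auto intro: submonoid_gen.gen)

text \<open>A sum of at least two generators equal to \<open>s\<^sub>i\<close> would have a smaller \<open>\<Sum> u\<^sub>j A\<^sub>j\<close> than \<open>A\<^sub>i\<close>,
  while both are congruent and below \<open>m\<close>.\<close>

lemma s_irreducible:
  assumes i: "i \<le> N" and y: "y \<in> submonoid_gen (s ` {..N})" "y \<noteq> 0"
    and z: "z \<in> submonoid_gen (s ` {..N})" "z \<noteq> 0"
  shows "s i \<noteq> y + z"
proof
  assume eq: "s i = y + z"
  obtain u where u: "y = (\<Sum>j\<le>N. u j * s j)" using y(1) by (rule submonoid_gen_imageE)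
  obtain v where v: "z = (\<Sum>j\<le>N. v j * s j)" using z(1) by (rule submonoid_gen_imageE)
  define w where "w j = u j + v j" for j
  have "(\<Sum>j\<le>N. u j) \<noteq> 0" "(\<Sum>j\<le>N. v j) \<noteq> 0"
    using y(2) z(2) unfolding u v by auto
  then have len: "2 \<le> (\<Sum>j\<le>N. w j)"
    unfolding w_def sum.distrib by linarith
  have sw: "(\<Sum>j\<le>N. w j * s j) = s i"
    unfolding eq u v w_def by (simp add: distrib_right sum.distrib)
  have "m * 2 \<le> m * (\<Sum>j\<le>N. w j)"
    using len by (rule mult_left_mono) simp
  \<comment> \<open>Two or more generators contribute at least \<open>2 * m\<close>, whereas
    \<open>s i\<close> contains \<open>m\<close> once; the excess must be saved in the multiple of
    \<open>d\<close>.\<close>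
  then have "d * (\<Sum>j\<le>N. w j * repunit a j) < d * repunit a i"
    using sw m unfolding sum_s unfolding s_def by linarith
  then have less: "(\<Sum>j\<le>N. w j * repunit a j) < repunit a i"
    by simp
  have "[(\<Sum>j\<le>N. w j * repunit a j) = repunit a i] (mod m)"
    using sw by (intro value_cong) (simp add: s_def cong_def)
  then show False
    using less repunit_less[OF i] by (simp add: cong_def)
qed

lemma msg_gen: "msg (submonoid_gen (range s)) = s ` {..N}"
proof (rule msg_eqI)
  show "0 \<notin> s ` {..N}"
    using m by (auto simp: s_def)
qed (use gen_range_s s_irreducible in auto)

lemma ap_elem_eq:
  assumes c: "canonical a N c" "(\<Sum>i=1..N. c i * repunit a i) = l" and l: "l < m"
    and k: "[int d * int l = k] (mod int m)"
  shows "ap_elem (submonoid_gen (range s)) (int m) k = (\<Sum>i=1..N. c i * s i)"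
proof -
  let ?w = "\<Sum>i=1..N. c i * s i"
  have w: "[?w = d * l] (mod m)"
    unfolding sum_s c(2) by (simp add: cong_def)
  have "[int ?w = k] (mod int m)"
    using w k cong_trans by (metis cong_int_iff of_nat_mult)
  then have *: "[int w' = k] (mod int m) \<longleftrightarrow> [int w' = int ?w] (mod int m)" for w'
    by (metis cong_sym cong_trans)
  have m_in: "m \<in> submonoid_gen (range s)"
    using submonoid_gen.gen[OF rangeI, of s 0] by (simp add: s_def[of 0])
  have "w' \<in> Ap (submonoid_gen (range s)) (int m) \<and> [int w' = int ?w] (mod int m)
      \<longleftrightarrow> w' = ?w" for w'
  proof (rule Ap_unique)
    show "?w \<in> submonoid_gen (range s)"
      by (intro submonoid_gen_sum submonoid_gen.gen) auto
    show "x + q * m \<in> submonoid_gen (range s)" if "x \<in> submonoid_gen (range s)" for x q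
      using that m_in by (intro submonoid_gen.add submonoid_gen_mult)
    show "?w \<le> x" if x: "x \<in> submonoid_gen (range s)" "[x = ?w] (mod m)" for x
    proof -
      \<comment> \<open>Minimality is known for combinations of \<open>s 0\<close>, ...,
        \<open>s N\<close>; \<open>gen_range_s\<close> brings every element of the semigroup into
        this form.\<close>
      obtain u where u: "x = (\<Sum>i\<le>N. u i * s i)"
        using x(1) submonoid_gen_imageE unfolding gen_range_s by blast
      show ?thesis
        using canonical_sum_minimal(1)[OF c l, of u] cong_trans[OF x(2) w] unfolding u by blast
    qed
  qed (use m in simp)
  then show ?thesis
    unfolding ap_elem_def * by simp
qed

lemma factorization_lengths_eq:
  assumes c: "canonical a N c" "(\<Sum>i=1..N. c i * repunit a i) = l" and l: "l < m"
  shows "factorization_lengths (s ` {..N}) (\<Sum>i=1..N. c i * s i) = {\<Sum>i=1..N. c i}"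
proof -
  have reindex: "(\<Sum>\<beta>\<in>s ` {..N}. f \<beta>) = (\<Sum>i\<le>N. f (s i))" for f :: "nat \<Rightarrow> nat"
    using inj_s by (simp add: sum.reindex inj_on_def)
  have w: "[(\<Sum>i=1..N. c i * s i) = d * l] (mod m)"
    unfolding sum_s c(2) by (simp add: cong_def)
  show ?thesis
  proof (rule equalityI; rule subsetI)
    fix x assume "x \<in> factorization_lengths (s ` {..N}) (\<Sum>i=1..N. c i * s i)"
    then obtain u where "x = (\<Sum>i\<le>N. u (s i))"
      "(\<Sum>i=1..N. c i * s i) = (\<Sum>i\<le>N. u (s i) * s i)"
      unfolding factorization_lengths_def reindex by blast
    then show "x \<in> {\<Sum>i=1..N. c i}"
      using canonical_sum_minimal(2)[OF c l, of "\<lambda>i. u (s i)"] w by simp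
  next
    fix x assume "x \<in> {\<Sum>i=1..N. c i}"
    \<comment> \<open>Factorizations are indexed by generators, so \<open>c\<close> is transported
      along the inverse of \<open>s\<close>. The generator \<open>s 0 = m\<close> gets coefficient
      0, as \<open>c\<close> matters only on \<open>{1..N}\<close>.\<close>
    moreover define u where "u = (\<lambda>\<beta>. if inv s \<beta> = 0 then 0 else c (inv s \<beta>))"
    moreover have "u (s i) = (if i = 0 then 0 else c i)" for i
      unfolding u_def using inj_s by (simp add: inv_f_f)
    ultimately have "x = (\<Sum>i\<le>N. u (s i))"
      "(\<Sum>i=1..N. c i * s i) = (\<Sum>i\<le>N. u (s i) * s i)"
      by (simp_all add: sum_atMost_split)
    then show "x \<in> factorization_lengths (s ` {..N}) (\<Sum>i=1..N. c i * s i)"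
      unfolding factorization_lengths_def reindex by blast
  qed
qed

section \<open>Transfer to the integer definitions\<close>

lemma orbit_eq:
  assumes "int d = (int a - 1) * int m + b"
  shows "(T (int a) b ^^ i) (int m) = int (s i)"
proof (induction i)
  case 0
  then show ?case by (simp add: s_def)
next
  case (Suc i)
  have b: "b = int d - (int a - 1) * int m"
    using assms by simp
  show ?case
    unfolding funpow.simps o_apply Suc by (simp add: T_def s_def b algebra_simps)
qed

lemma canonical_rep_props:
  assumes "l < m"
  shows "canonical a N (canonical_rep (int a) (Suc N) (int l))" (is "canonical a N ?c")
    and "(\<Sum>i=1..N. canonical_rep (int a) (Suc N) (int l) i * repunit a i) = l"
proof -
  have R: "u \<in> R (int a) (Suc N) \<longleftrightarrow> u \<in> {1..N} \<rightarrow>\<^sub>E UNIV \<and> canonical a N u" for u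
    unfolding R_def canonical_def by auto
  have "int l = (\<Sum>i=1..N. int (u i) * A (int a) i) \<longleftrightarrow> (\<Sum>i=1..N. u i * repunit a i) = l" for u
  proof -
    have "(\<Sum>i=1..N. int (u i) * A (int a) i) = int (\<Sum>i=1..N. u i * repunit a i)"
      using int_repunit[OF a] by simp
    then show ?thesis by (simp only: of_nat_eq_iff) auto
  qed
  then have "?c = (THE c. c \<in> {1..N} \<rightarrow>\<^sub>E UNIV \<and> canonical a N c
      \<and> (\<Sum>i=1..N. c i * repunit a i) = l)"
    unfolding canonical_rep_def R diff_Suc_1 by (simp add: conj_assoc)
  then have "canonical a N ?c \<and> (\<Sum>i=1..N. ?c i * repunit a i) = l"
    using theI'[OF canonical_ex1[OF assms]] by simp
  then show "canonical a N ?c" "(\<Sum>i=1..N. ?c i * repunit a i) = l"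
    by blast+
qed

end

lemma ell_props:
  assumes "0 < m" "coprime ((a - 1) * m + b) m"
  shows "ell a b m k \<in> {0..m - 1}" "[((a - 1) * m + b) * ell a b m k = k] (mod m)"
proof -
  let ?d = "(a - 1) * m + b"
  have "\<exists>!l. l \<in> {0..m - 1} \<and> [?d * l = k] (mod m)"
  proof (rule ex_ex1I)
    obtain x where "[?d * x = 1] (mod m)"
      using cong_solve_coprime_int[OF assms(2)] by blast
    then have "[?d * x * k = 1 * k] (mod m)"
      by (rule cong_scalar_right)
    then have "[?d * (x * k mod m) = k] (mod m)"
      unfolding cong_def mod_mult_right_eq by (simp add: mult.assoc)
    moreover have "x * k mod m \<in> {0..m - 1}"
      using assms(1) by simp
    ultimately show "\<exists>l. l \<in> {0..m - 1} \<and> [?d * l = k] (mod m)" by blast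
  next
    fix l l' assume l: "l \<in> {0..m - 1} \<and> [?d * l = k] (mod m)"
      "l' \<in> {0..m - 1} \<and> [?d * l' = k] (mod m)"
    then have "[?d * l = ?d * l'] (mod m)"
      by (metis cong_sym cong_trans)
    then have "[l = l'] (mod m)"
      using assms(2) by (simp add: cong_mult_lcancel)
    then show "l = l'"
      using l by (simp add: cong_def)
  qed
  from theI'[OF this] show "ell a b m k \<in> {0..m - 1}" "[?d * ell a b m k = k] (mod m)"
    unfolding ell_def by blast+
qed

theorem corollary4p6:
  fixes a b m k :: int and n :: nat
  assumes "a \<ge> 2" and "m > 1" and "gcd b m = 1" and "b \<ge> - (a - 2) * m - 2"
    and "n = (LEAST j. 0 < j \<and> A a j \<ge> m)"
    and "k \<in> {0..m - 1}"
  shows "int (ap_elem (S a b m) m k) =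
           (\<Sum>i = 1..n - 1. int (canonical_rep a n (ell a b m k) i) * (T a b ^^ i) m)
       \<and> factorization_lengths (msg (S a b m)) (ap_elem (S a b m) m k) =
           {\<Sum>i = 1..n - 1. canonical_rep a n (ell a b m k) i}"
proof -
  define a' m' where "a' = nat a" and "m' = nat m"
  then have a': "a = int a'" "2 \<le> a'" and m': "m = int m'" "2 \<le> m'"
    using assms(1,2) by auto
  \<comment> \<open>This coefficient differs from \<open>b\<close> by a multiple of
    \<open>m\<close>, so it has the same gcd with \<open>m\<close>.\<close>
  have cop: "coprime ((a - 1) * m + b) m"
    using assms(3) by (simp add: coprime_iff_gcd_eq_1 gcd.commute[of _ m] gcd_add_mult)
  have d_ge: "m - 2 \<le> (a - 1) * m + b"
    using assms(4) by (simp add: algebra_simps)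
  \<comment> \<open>The bound alone leaves the value 0 possible when \<open>m = 2\<close>;
    coprimality to \<open>m > 1\<close> excludes it.\<close>
  then have "(a - 1) * m + b \<noteq> 0"
    using cop assms(2) by (intro notI) simp
  then have d_pos: "0 < (a - 1) * m + b"
    using d_ge assms(2) by linarith
  define d where "d = nat ((a - 1) * m + b)"
  then have d_eq: "(a - 1) * m + b = int d" "0 < d"
    using d_pos by simp_all
  define P where "P j \<longleftrightarrow> 0 < j \<and> A a j \<ge> m" for j
  have P_iff: "P j \<longleftrightarrow> 0 < j \<and> m' \<le> repunit a' j" for j
    unfolding P_def a' m' int_repunit[OF a'(2), symmetric] by simp
  \<comment> \<open>A strictly increasing sequence of naturals satisfies
    \<open>j \<le> repunit a' j\<close>, so the minimum defining \<open>n\<close> is taken over a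
    nonempty set.\<close>
  have "P m'"
    using strict_mono_imp_increasing[OF repunit_strict_mono[OF a'(2)]] m' by (simp add: P_iff)
  then have "P n"
    unfolding assms(5) P_def by (rule LeastI)
  then obtain N where n_eq: "n = Suc N"
    unfolding P_iff by (cases n) auto
  \<comment> \<open>For \<open>n = 1\<close> the value would be \<open>repunit a' 1 = 1\<close>,
    below \<open>m'\<close>. With \<open>N > 0\<close>, minimality of \<open>n\<close> then gives
    \<open>repunit a' N < m'\<close>.\<close>
  have "N \<noteq> 0"
    using \<open>P n\<close> m' unfolding P_iff n_eq by (intro notI) simp
  moreover have "\<not> P N"
    unfolding P_def using n_eq assms(5) by (metis not_less_Least lessI)
  ultimately interpret repunit_orbit a' m' d N
    using a' m' d_eq d_ge cop \<open>P n\<close> by unfold_locales (auto simp: P_iff n_eq)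
  have orbit: "(T a b ^^ i) m = int (s i)" for i
    using orbit_eq d_eq(1) unfolding a' m' by simp
  have S: "S a b m = submonoid_gen (range s)"
    unfolding S_def orbit by (simp add: image_def)
  define l where "l = nat (ell a b m k)"
  then have l: "ell a b m k = int l" "l < m'"
    using ell_props(1)[OF _ cop, of k] m' by auto
  have k: "[int d * int l = k] (mod int m')"
    using ell_props(2)[OF _ cop, of k] m' unfolding d_eq(1) l by simp
  note c = canonical_rep_props[OF l(2)]
  show ?thesis
    unfolding S msg_gen unfolding orbit l n_eq diff_Suc_1 unfolding a' m'
    unfolding ap_elem_eq[OF c l(2) k] factorization_lengths_eq[OF c l(2)]
    by simp
qed

end
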